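(* Let $q$ be an odd prime power and $d\ge 3$. For all $\lambda\in \mathbb{F}_q$, there exists $E\subset \mathbb{F}_q^d$ with $|E|=q$ such that for all $\mathbf{y}\in \mathbb{F}_q^{d-1}\times \{\lambda\}$ one has $|\{\mathbf{y}\cdot \mathbf x:\mathbf x\in E\}|\le \frac{q+1}{2}$; consequently $$\mathcal{T}_1 \left( X_\pi , E , \frac{q+1}{2} \right) =X_\pi.$$
   Context: $\mathbb F_q$ is the finite field with $q$ elements. For $\mathbf x\in\mathbb F_q^d$, $\|\mathbf x\|=x_1^2+\cdots+x_d^2$, and $\mathbf x\cdot\mathbf y=\sum_i x_iy_i$. $S^{d-1}=\{\mathbf x\in\mathbb F_q^d:\|\mathbf x\|=1\}$, $\pi=\{\mathbf x\in\mathbb F_q^d: x_d=\lambda\}$. $X_\pi$ is the set of lines through the origin (one-dimensional linear subspaces of $\mathbb F_q^d$) that contain a nonzero element of $\pi\cap S^{d-1}$. For a linear subspace $V$, $V^\perp=\{\mathbf x\in\mathbb F_q^d:\mathbf x\cdot\mathbf y=0\ \forall \mathbf y\in V\}$, and $\pi_V(E)=\{\mathbf x+V^\perp:\mathbf x\in\mathbb F_q^d,\ (\mathbf x+V^\perp)\cap E\neq\emptyset\}$, a set of cosets. $\mathcal T_1(X_\pi,E,N)=\{V\in X_\pi: |\pi_V(E)|\le N\}$. *)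

theory Defs
  imports "HOL-Analysis.Cartesian_Space"
begin

text \<open>The space of \<open>d\<close>-tuples over a finite field is \<open>'a ^ 'n\<close> with \<open>CARD('a) = q\<close> and
  \<open>CARD('n) = d\<close>. The index type is linearly ordered so that there is a last (\<open>d\<close>-th) coordinate.\<close>

definition last_index :: "'n::{finite,linorder}" where
  "last_index = Max UNIV"

definition dot :: "'a::field ^ 'n::finite \<Rightarrow> 'a ^ 'n \<Rightarrow> 'a" where
  "dot x y = (\<Sum>i\<in>UNIV. x $ i * y $ i)"

definition qnorm :: "'a::field ^ 'n::finite \<Rightarrow> 'a" where
  "qnorm x = (\<Sum>i\<in>UNIV. (x $ i)\<^sup>2)"

definition unit_sphere :: "('a::field ^ 'n::finite) set" where
  "unit_sphere = {x. qnorm x = 1}"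

definition hyperplane :: "'a::field \<Rightarrow> ('a ^ 'n::{finite,linorder}) set" where
  "hyperplane l = {x. x $ last_index = l}"

text \<open>Subspaces and dimension are over the scalar field \<open>'a\<close> itself (scalar multiplication
  \<open>*s\<close>).\<close>

definition lines_through :: "'a::field \<Rightarrow> ('a ^ 'n::{finite,linorder}) set set" where
  "lines_through l =
     {V. vec.subspace V \<and> vec.dim V = 1 \<and>
         (\<exists>x\<in>V. x \<noteq> 0 \<and> x \<in> hyperplane l \<inter> unit_sphere)}"

definition perp :: "('a::field ^ 'n::finite) set \<Rightarrow> ('a ^ 'n) set" where
  "perp V = {x. \<forall>y\<in>V. dot x y = 0}"

definition proj_cosets :: "('a::field ^ 'n::finite) set \<Rightarrow> ('a ^ 'n) set \<Rightarrow> ('a ^ 'n) set set" where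
  "proj_cosets V E = {(+) x ` perp V | x. ((+) x ` perp V) \<inter> E \<noteq> {}}"

text \<open>The bound \<open>N\<close> is real, so that \<open>(q + 1) / 2\<close> is exact.\<close>

definition exceptional_lines ::
  "('a::field ^ 'n::finite) set set \<Rightarrow> ('a ^ 'n) set \<Rightarrow> real \<Rightarrow> ('a ^ 'n) set set" where
  "exceptional_lines X E N = {V \<in> X. real (card (proj_cosets V E)) \<le> N}"

end

theory Submission imports Defs begin

text \<open>For \<open>\<lambda> = 0\<close> the last coordinate axis projects to a single point. For \<open>\<lambda> \<noteq> 0\<close> take the
  parabola \<open>{(t, 0, \<dots>, 0, t\<^sup>2)}\<close>: its projections \<open>t \<mapsto> y\<^sub>1 t + \<lambda> t\<^sup>2\<close> are quadratic polynomials,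
  invariant under the reflection \<open>t \<mapsto> - y\<^sub>1 / \<lambda> - t\<close>, which has exactly one fixed point in odd
  characteristic.\<close>

lemma two_neq_zero_if_odd_card:
  assumes "odd CARD('a::{field,finite})"
  shows "(2::'a) \<noteq> 0"
proof
  assume two: "(2::'a) = 0"
  \<comment> \<open>Translation by 1 permutes the field, so comparing sums of all elements gives \<open>q = 0\<close>.\<close>
  have "(\<Sum>x\<in>(UNIV::'a set). x) = (\<Sum>x\<in>(UNIV::'a set). x + 1)"
    by (rule sum.reindex_bij_witness[of _ "\<lambda>x. x + 1" "\<lambda>x. x - 1"]) auto
  then have "of_nat CARD('a) = (0::'a)"
    by (simp add: sum.distrib)
  moreover obtain k where "CARD('a) = 2 * k + 1"
    using assms by (elim oddE)
  ultimately show False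
    using two by simp
qed

text \<open>Every nonempty fibre of \<open>f\<close> on \<open>S\<close> contains, with a point
  \<open>x\<close>, also the different point \<open>\<sigma> x\<close>. Hence it has at least two
  elements, and the fibres partition \<open>S\<close>.\<close>

lemma double_card_image_le:
  assumes "finite S"
    and \<sigma>: "\<And>x. x \<in> S \<Longrightarrow> \<sigma> x \<in> S" "\<And>x. x \<in> S \<Longrightarrow> \<sigma> x \<noteq> x" "\<And>x. x \<in> S \<Longrightarrow> f (\<sigma> x) = f x"
  shows "2 * card (f ` S) \<le> card S"
proof -
  have "2 \<le> card {x \<in> S. f x = v}" if "v \<in> f ` S" for v
  proof -
    obtain x where x: "x \<in> S" "v = f x" using \<open>v \<in> f ` S\<close> by auto
    then have "card {x, \<sigma> x} \<le> card {x \<in> S. f x = v}"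
      using assms by (intro card_mono) auto
    then show ?thesis using \<sigma>(2)[OF x(1)] by (simp add: eq_commute)
  qed
  then have "(\<Sum>v\<in>f ` S. 2) \<le> (\<Sum>v\<in>f ` S. card {x \<in> S. f x = v})"
    by (intro sum_mono)
  also have "\<dots> = card S"
    using sum.image_gen[OF \<open>finite S\<close>, of "\<lambda>_. 1::nat" f] by simp
  finally show ?thesis by simp
qed

text \<open>Away from the vertex of the parabola, reflection pairs the q - 1 remaining arguments,
  which leaves at most (q - 1)/2 values; the vertex adds at most one more.\<close>

lemma card_range_quadratic_le:
  fixes a b :: "'a::{field,finite}"
  assumes "odd CARD('a)" and "a \<noteq> 0"
  shows "2 * card (range (\<lambda>t. b * t + a * t\<^sup>2)) \<le> CARD('a) + 1"
proof -
  let ?f = "\<lambda>t. b * t + a * t\<^sup>2"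
  \<comment> \<open>The vertex, which is the only solution of t = - b / a - t because 2 is
    invertible.\<close>
  define t0 where "t0 = - b / (2 * a)"
  have two: "(2::'a) \<noteq> 0" using assms(1) by (rule two_neq_zero_if_odd_card)
  have fixed: "2 * t0 = - b / a" using two assms(2) by (simp add: t0_def)
  have "2 * card (?f ` (UNIV - {t0})) \<le> card (UNIV - {t0})"
  proof (rule double_card_image_le[where \<sigma> = "\<lambda>t. - b / a - t"])
    fix t assume t: "t \<in> UNIV - {t0}"
    show "- b / a - t \<in> UNIV - {t0}" using t fixed by (auto simp: algebra_simps)
    show "- b / a - t \<noteq> t"
    proof
      assume "- b / a - t = t"
      then have "2 * t = 2 * t0" unfolding fixed by (simp add: algebra_simps)
      then show False using t two by simp
    qed
    \<comment> \<open>f(s) - f(t) = (s - t)(b + a(s + t)), and the second factor vanishes when s + t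
      = - b / a.\<close>
    show "?f (- b / a - t) = ?f t"
      using assms(2) by (simp add: field_simps power2_eq_square)
  qed simp
  moreover have "card (range ?f) \<le> card (?f ` (UNIV - {t0})) + 1"
  proof -
    have "range ?f = insert (?f t0) (?f ` (UNIV - {t0}))" by blast
    then show ?thesis by (simp add: card_insert_if)
  qed
  moreover have "card (UNIV - {t0}) = CARD('a) - 1" by (simp add: card_Diff_singleton)
  \<comment> \<open>Positivity makes the truncated subtraction in \<open>CARD('a) - 1\<close>
    exact.\<close>
  moreover have "CARD('a) > 0" by simp
  ultimately show ?thesis by linarith
qed

lemma dot_commute: "dot x y = dot y x"
  by (simp add: dot_def mult.commute)

lemma dot_add_right: "dot x (y + z) = dot x y + dot x z"
  by (simp add: dot_def algebra_simps sum.distrib)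

lemma dot_diff_right: "dot x (y - z) = dot x y - dot x z"
  by (simp add: dot_def algebra_simps sum_subtractf)

lemma dot_scale_right: "dot x (c *s y) = c * dot x y"
  by (simp add: dot_def sum_distrib_left mult.left_commute)

lemma dot_axis: "dot y (axis i c) = y $ i * c"
proof -
  have "(\<Sum>k\<in>UNIV. y $ k * axis i c $ k) = (\<Sum>k\<in>UNIV. if k = i then y $ i * c else 0)"
    by (rule sum.cong) (auto simp: axis_def)
  then show ?thesis by (simp add: dot_def)
qed

lemma perp_line:
  assumes "vec.dim V = 1" and "y \<in> V" and "y \<noteq> 0"
  shows "perp V = {x. dot y x = 0}"
proof -
  \<comment> \<open>A nonzero vector is an independent set of size 1, which is the dimension of
    \<open>V\<close>, so it spans \<open>V\<close>.\<close>
  have "V \<subseteq> vec.span {y}"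
    by (rule vec.card_ge_dim_independent) (use assms in auto)
  then have "\<exists>c. v = c *s y" if "v \<in> V" for v
    using that by (auto simp: vec.span_singleton)
  then have "dot x v = 0" if "dot y x = 0" "v \<in> V" for x v
    using that by (metis dot_commute dot_scale_right mult_zero_right)
  then show ?thesis
    using assms(2) by (auto simp: perp_def dot_commute)
qed

text \<open>The cosets of \<open>perp V\<close> are the level sets of \<open>dot y\<close>, so a
  coset that meets \<open>E\<close> is determined by the value of \<open>dot y\<close> at any point
  of \<open>E\<close> in it.\<close>

lemma card_proj_cosets_le:
  assumes "vec.dim V = 1" and "y \<in> V" and "y \<noteq> 0" and "finite E"
  shows "card (proj_cosets V E) \<le> card (dot y ` E)"
proof -
  have coset: "(+) x ` perp V = {z. dot y z = dot y x}" for x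
  proof -
    have "z \<in> (+) x ` perp V" if "dot y z = dot y x" for z
      using that by (intro image_eqI[of _ _ "z - x"])
        (auto simp: perp_line[OF assms(1-3)] dot_diff_right)
    then show ?thesis by (auto simp: perp_line[OF assms(1-3)] dot_add_right)
  qed
  have "proj_cosets V E \<subseteq> (\<lambda>c. {z. dot y z = c}) ` dot y ` E"
  proof
    fix W assume "W \<in> proj_cosets V E"
    then obtain x e where "W = {z. dot y z = dot y x}" "e \<in> W" "e \<in> E"
      unfolding proj_cosets_def coset by blast
    then have "W = {z. dot y z = dot y e}" by simp
    with \<open>e \<in> E\<close> show "W \<in> (\<lambda>c. {z. dot y z = c}) ` dot y ` E" by blast
  qed
  then show ?thesis
    using assms(4) by (meson card_image_le card_mono finite_imageI le_trans)
qed

text \<open>Reduces the claim about lines to dot products: each line in question contains a nonzero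
  \<open>y\<close> in the hyperplane, and the bound for \<open>y\<close> passes to the
  cosets.\<close>

lemma exceptional_lines_eq_lines_through:
  assumes "finite E" and "\<And>y. y \<in> hyperplane l \<Longrightarrow> real (card (dot y ` E)) \<le> N"
  shows "exceptional_lines (lines_through l) E N = lines_through l"
proof -
  have "real (card (proj_cosets V E)) \<le> N" if "V \<in> lines_through l" for V
  proof -
    obtain y where "vec.dim V = 1" "y \<in> V" "y \<noteq> 0" "y \<in> hyperplane l"
      using \<open>V \<in> lines_through l\<close> by (auto simp: lines_through_def)
    then show ?thesis
      using card_proj_cosets_le[of V y E] assms
      by (meson of_nat_le_iff order_trans)
  qed
  then show ?thesis by (auto simp: exceptional_lines_def)
qed

lemma exists_set_few_dot_values:
  fixes l :: "'a::{field,finite}"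
  assumes "odd CARD('a)" and "CARD('n::{finite,linorder}) \<ge> 2"
  shows "\<exists>E :: ('a ^ 'n::{finite,linorder}) set. card E = CARD('a) \<and>
           (\<forall>y\<in>hyperplane l. 2 * card (dot y ` E) \<le> CARD('a) + 1)"
proof -
  let ?m = "last_index :: 'n"
  have "(UNIV :: 'n set) \<noteq> {?m}"
  proof
    assume "(UNIV :: 'n set) = {?m}"
    then have "CARD('n) = card {?m}" by (rule arg_cong)
    then show False using assms(2) by simp
  qed
  then obtain j where j: "j \<noteq> ?m" by blast
  \<comment> \<open>For \<open>l = 0\<close> every \<open>y\<close> in the hyperplane is orthogonal
    to the last axis. Otherwise the last coordinate \<open>l\<close> of \<open>y\<close> becomes the
    leading coefficient of a quadratic in \<open>t\<close>.\<close>
  define g :: "'a \<Rightarrow> 'a ^ 'n::{finite,linorder}" where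
    "g t = (if l = 0 then axis ?m t else axis j t + axis ?m (t\<^sup>2))" for t
  \<comment> \<open>One coordinate recovers the parameter, so the curve has exactly q
    points.\<close>
  have "g t $ (if l = 0 then ?m else j) = t" for t
    using j by (simp add: g_def axis_def)
  then have "inj g" by (metis injI)
  then have "card (range g) = CARD('a)" by (rule card_image)
  moreover have "2 * card (dot y ` range g) \<le> CARD('a) + 1" if "y \<in> hyperplane l" for y
  proof -
    have ym: "y $ ?m = l" using that by (simp add: hyperplane_def)
    show ?thesis
    proof (cases "l = 0")
      case True
      then have "dot y ` range g = {0}" by (simp add: g_def dot_axis ym image_image)
      moreover have "CARD('a) > 0" by simp
      ultimately show ?thesis by simp
    next
      case False
      then have "dot y ` range g = range (\<lambda>t. y $ j * t + l * t\<^sup>2)"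
        by (simp add: g_def dot_add_right dot_axis ym image_image)
      then show ?thesis using card_range_quadratic_le[OF assms(1) False] by simp
    qed
  qed
  ultimately show ?thesis by blast
qed

theorem mainTheorem6:
  fixes q d :: nat
  assumes "CARD('a::{field,finite}) = q" and "odd q"
    and "CARD('n::{finite,linorder}) = d" and "d \<ge> 3"
  shows "\<forall>l::'a. \<exists>E :: ('a ^ 'n::{finite,linorder}) set.
           card E = q \<and>
           (\<forall>y\<in>hyperplane l. real (card {dot y x | x. x \<in> E}) \<le> (real q + 1) / 2) \<and>
           exceptional_lines (lines_through l) E ((real q + 1) / 2) = lines_through l"
proof
  fix l :: 'a
  obtain E :: "('a ^ 'n::{finite,linorder}) set" where E: "card E = q"
    and few: "\<forall>y\<in>hyperplane l. 2 * card (dot y ` E) \<le> q + 1"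
    using exists_set_few_dot_values[where 'a = 'a and 'n = 'n] assms by fastforce
  have bound: "real (card (dot y ` E)) \<le> (real q + 1) / 2" if "y \<in> hyperplane l" for y
    using of_nat_mono[OF few[rule_format, OF that], where 'a = real] by simp
  \<comment> \<open>An infinite set has \<open>card\<close> equal to 0, so a positive cardinality
    forces \<open>E\<close> to be finite.\<close>
  have "q > 0" using assms(2) by (rule odd_pos)
  then have "finite E" using E by (metis card.infinite less_irrefl)
  then have "exceptional_lines (lines_through l) E ((real q + 1) / 2) = lines_through l"
    using bound by (rule exceptional_lines_eq_lines_through)
  then show "\<exists>E :: ('a ^ 'n::{finite,linorder}) set. card E = q \<and>
      (\<forall>y\<in>hyperplane l. real (card {dot y x | x. x \<in> E}) \<le> (real q + 1) / 2) \<and>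
      exceptional_lines (lines_through l) E ((real q + 1) / 2) = lines_through l"
    using E bound by (auto simp: Setcompr_eq_image)
qed

end
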